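(* Let $M$ be a compact $d$-dimensional Riemannian manifold without boundary, $u\in C^1(M)$, $x_0\in M$ any point, and $\nu$ a unit vector in the tangent plane of $M$ at $x_0$. Let $u^h$ be a discrete approximation of $u$ on the point cloud $\mathcal{G}^h\subset M$, and consider finite difference approximations of the form $$\mathcal{D}_\nu v(x_0)=\frac1r\sum_{i=1}^k a_i\,(v(x_i)-v(x_0)),$$ where $x_i\in\mathcal{G}^h$ are discretization points and $r$ is the stencil width. Assume: (1) there exists $p>0$ such that at every point $x\in\mathcal{G}^h$, $u(x)=u^h(x)+\mathcal{O}(h^p)$; (2) the stencil width satisfies $r\ge h$ for every $h>0$; (3) there exist constants $C_1,C_2>0$ such that for every $\mathcal{G}^h$ there exist points $x_1,\dots,x_k\in\mathcal{G}^h$ (those used in $\mathcal{D}_\nu$) satisfying $C_1 r\le |x_i-x_0|\le C_2 r$ for $i=1,\dots,k$; (4) there exists $\beta>0$ such that the approximation applied to the limiting function $u$ satisfies $\mathcal{D}_\nu u(x_0)=\frac{\partial u(x_0)}{\partial\nu}+\mathcal{O}(r^\beta)$; (5) the coefficients satisfy $a_i=\mathcal{O}(1)$ as $h\to0$. Choose $r=\mathcal{O}\!\left(h^{p/(\beta+1)}\right)$. Then $$\frac{\partial u(x_0)}{\partial\nu}=\mathcal{D}_\nu u^h(x_0)+\mathcal{O}\!\left(h^{\frac{p\beta}{\beta+1}}\right).$$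
   Context: $\mathcal{G}^h\subset M$ is a point cloud discretizing $M$, with $h=\sup_{x\in M}\min_{y\in\mathcal{G}^h}d_M(x,y)$, where $d_M$ is the geodesic distance. $\frac{\partial u(x_0)}{\partial\nu}$ is the first directional derivative of $u$ at $x_0$ in the direction $\nu$. The problem is viewed in the tangent plane at $x_0$ (identified with $\mathbb{R}^d$) by projecting nearby points through geodesic normal coordinates, which preserve distance from $x_0$; $|x_i-x_0|$ is the distance from $x_i$ to $x_0$ there.
   Formalization: The choice r = O(h^{p/(β+1)}) is taken as exact order (bounded above and below by multiples of h^{p/(β+1)}), since r = h can break the claim; and u(x_0) = u^h(x_0) + O(h^p) is also required at x_0 when x_0 is not a cloud point, where u^h(x_0) would be undefined. *)

theory Defs
  imports "HOL-Analysis.Analysis" "HOL-Library.Landau_Symbols"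
begin

primrec Ck_on :: "nat \<Rightarrow> 'e::euclidean_space set \<Rightarrow> ('e \<Rightarrow> 'b::real_normed_vector) \<Rightarrow> bool" where
  "Ck_on 0 S f \<longleftrightarrow> continuous_on S f"
| "Ck_on (Suc k) S f \<longleftrightarrow>
     (\<forall>y\<in>S. f differentiable at y) \<and> (\<forall>v. Ck_on k S (\<lambda>y. frechet_derivative f (at y) v))"

definition smooth_on :: "'e::euclidean_space set \<Rightarrow> ('e \<Rightarrow> 'b::real_normed_vector) \<Rightarrow> bool" where
  "smooth_on S f \<longleftrightarrow> (\<forall>k. Ck_on k S f)"

(* A chart is its domain together with its coordinate map; the map is irrelevant off the domain. *)
type_synonym ('a, 'e) chart = "'a set \<times> ('a \<Rightarrow> 'e)"

definition chart_inv :: "('a, 'e) chart \<Rightarrow> 'e \<Rightarrow> 'a" where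
  "chart_inv c = inv_into (fst c) (snd c)"

definition is_chart :: "'a topology \<Rightarrow> ('a, 'e::euclidean_space) chart \<Rightarrow> bool" where
  "is_chart M c \<longleftrightarrow> openin M (fst c) \<and> open (snd c ` fst c) \<and>
     homeomorphic_map (subtopology M (fst c)) (top_of_set (snd c ` fst c)) (snd c)"

definition smooth_transition :: "('a, 'e::euclidean_space) chart \<Rightarrow> ('a, 'e) chart \<Rightarrow> bool" where
  "smooth_transition c c' \<longleftrightarrow> smooth_on (snd c ` (fst c \<inter> fst c')) (snd c' \<circ> chart_inv c)"

locale smooth_manifold =
  fixes M :: "'a topology" and A :: "('a, 'e::euclidean_space) chart set"
  assumes Hausdorff: "Hausdorff_space M"
    and second_countable: "second_countable M"
    and charts: "c \<in> A \<Longrightarrow> is_chart M c"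
    and covering: "(\<Union>c\<in>A. fst c) = topspace M"
    and compatible: "c \<in> A \<Longrightarrow> c' \<in> A \<Longrightarrow> smooth_transition c c'"

(* Local coordinate expressions: in chart c, g c y is the inner product on coordinate vectors
   at the coordinate y. *)
type_synonym ('a, 'e) metric = "('a, 'e) chart \<Rightarrow> 'e \<Rightarrow> 'e \<Rightarrow> 'e \<Rightarrow> real"

locale riemannian_manifold = smooth_manifold M A
  for M :: "'a topology" and A :: "('a, 'e::euclidean_space) chart set" +
  fixes g :: "('a, 'e) metric"
  assumes bilinear: "c \<in> A \<Longrightarrow> y \<in> snd c ` fst c \<Longrightarrow> bilinear (g c y)"
    and symmetric: "c \<in> A \<Longrightarrow> y \<in> snd c ` fst c \<Longrightarrow> g c y v w = g c y w v"
    and positive: "c \<in> A \<Longrightarrow> y \<in> snd c ` fst c \<Longrightarrow> v \<noteq> 0 \<Longrightarrow> g c y v v > 0"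
    and smooth: "c \<in> A \<Longrightarrow> smooth_on (snd c ` fst c) (\<lambda>y. g c y v w)"
    and tensorial: "c \<in> A \<Longrightarrow> c' \<in> A \<Longrightarrow> y \<in> snd c ` (fst c \<inter> fst c') \<Longrightarrow>
      (let \<tau> = snd c' \<circ> chart_inv c; D = frechet_derivative \<tau> (at y)
       in g c y v w = g c' (\<tau> y) (D v) (D w))"

locale compact_riemannian_manifold = riemannian_manifold +
  assumes compact: "compact_space M"

definition chart_at :: "('a, 'e) chart set \<Rightarrow> 'a \<Rightarrow> ('a, 'e) chart" where
  "chart_at A x = (SOME c. c \<in> A \<and> x \<in> fst c)"

(* A tangent vector at x is the family of its coordinate vectors in the charts around x, related
   by the differentials of the transition maps; its components in other charts are set to 0. *)
type_synonym ('a, 'e) tangent_vector = "('a, 'e) chart \<Rightarrow> 'e"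

definition tangent_space ::
  "('a, 'e::euclidean_space) chart set \<Rightarrow> 'a \<Rightarrow> ('a, 'e) tangent_vector set" where
  "tangent_space A x =
     {v. (\<forall>c\<in>A. \<forall>c'\<in>A. x \<in> fst c \<inter> fst c' \<longrightarrow>
            v c' = frechet_derivative (snd c' \<circ> chart_inv c) (at (snd c x)) (v c)) \<and>
         (\<forall>c. \<not> (c \<in> A \<and> x \<in> fst c) \<longrightarrow> v c = 0)}"

definition riem_inner ::
  "('a, 'e) chart set \<Rightarrow> ('a, 'e) metric \<Rightarrow> 'a \<Rightarrow> ('a, 'e) tangent_vector \<Rightarrow> ('a, 'e) tangent_vector \<Rightarrow> real"
  where
  "riem_inner A g x v w = (let c = chart_at A x in g c (snd c x) (v c) (w c))"

definition riem_norm ::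
  "('a, 'e) chart set \<Rightarrow> ('a, 'e) metric \<Rightarrow> 'a \<Rightarrow> ('a, 'e) tangent_vector \<Rightarrow> real" where
  "riem_norm A g x v = sqrt (riem_inner A g x v v)"

definition C1_manifold :: "('a, 'e::euclidean_space) chart set \<Rightarrow> ('a \<Rightarrow> real) \<Rightarrow> bool" where
  "C1_manifold A u \<longleftrightarrow> (\<forall>c\<in>A. Ck_on 1 (snd c ` fst c) (u \<circ> chart_inv c))"

definition directional_derivative ::
  "('a, 'e::euclidean_space) chart set \<Rightarrow> ('a \<Rightarrow> real) \<Rightarrow> 'a \<Rightarrow> ('a, 'e) tangent_vector \<Rightarrow> real" where
  "directional_derivative A u x \<nu> =
     (let c = chart_at A x in frechet_derivative (u \<circ> chart_inv c) (at (snd c x)) (\<nu> c))"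

definition velocity ::
  "('a, 'e::euclidean_space) chart set \<Rightarrow> (real \<Rightarrow> 'a) \<Rightarrow> real \<Rightarrow> ('a, 'e) tangent_vector" where
  "velocity A \<gamma> t =
     (\<lambda>c. if c \<in> A \<and> \<gamma> t \<in> fst c then vector_derivative (snd c \<circ> \<gamma>) (at t) else 0)"

definition piecewise_C1_curve ::
  "'a topology \<Rightarrow> ('a, 'e::euclidean_space) chart set \<Rightarrow> (real \<Rightarrow> 'a) \<Rightarrow> bool" where
  "piecewise_C1_curve M A \<gamma> \<longleftrightarrow>
     continuous_map (top_of_set {0..1}) M \<gamma> \<and>
     (\<forall>c\<in>A. \<forall>s t. 0 \<le> s \<and> s \<le> t \<and> t \<le> 1 \<and> \<gamma> ` {s..t} \<subseteq> fst c \<longrightarrow>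
        (snd c \<circ> \<gamma>) piecewise_C1_differentiable_on {s..t})"

definition curve_length ::
  "('a, 'e::euclidean_space) chart set \<Rightarrow> ('a, 'e) metric \<Rightarrow> (real \<Rightarrow> 'a) \<Rightarrow> ennreal" where
  "curve_length A g \<gamma> =
     (\<integral>\<^sup>+t\<in>{0..1}. ennreal (riem_norm A g (\<gamma> t) (velocity A \<gamma> t)) \<partial>lborel)"

(* Extended-real valued: points in different components are at distance infinity. *)
definition geodesic_dist ::
  "'a topology \<Rightarrow> ('a, 'e::euclidean_space) chart set \<Rightarrow> ('a, 'e) metric \<Rightarrow> 'a \<Rightarrow> 'a \<Rightarrow> ennreal" where
  "geodesic_dist M A g x y =
     (INF \<gamma>\<in>{\<gamma>. piecewise_C1_curve M A \<gamma> \<and> \<gamma> 0 = x \<and> \<gamma> 1 = y}. curve_length A g \<gamma>)"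

(* Christoffel symbol of the first kind of G at y, contracted with a, b, w:
   (D_a G(b,w) + D_b G(a,w) - D_w G(a,b)) / 2. *)
definition christoffel :: "('e::euclidean_space \<Rightarrow> 'e \<Rightarrow> 'e \<Rightarrow> real) \<Rightarrow> 'e \<Rightarrow> 'e \<Rightarrow> 'e \<Rightarrow> 'e \<Rightarrow> real" where
  "christoffel G y a b w =
     (frechet_derivative (\<lambda>z. G z b w) (at y) a + frechet_derivative (\<lambda>z. G z a w) (at y) b
      - frechet_derivative (\<lambda>z. G z a b) (at y) w) / 2"

(* Geodesics defined for all times, with the geodesic equation in lowered form
   g(c'', w) + Gamma(c', c'; w) = 0 for every w. *)
definition geodesic ::
  "'a topology \<Rightarrow> ('a, 'e::euclidean_space) chart set \<Rightarrow> ('a, 'e) metric \<Rightarrow> (real \<Rightarrow> 'a) \<Rightarrow> bool" where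
  "geodesic M A g \<gamma> \<longleftrightarrow>
     continuous_map euclideanreal M \<gamma> \<and>
     (\<forall>t. \<forall>c\<in>A. \<gamma> t \<in> fst c \<longrightarrow>
        (let y = snd c \<circ> \<gamma>; y' = (\<lambda>s. vector_derivative y (at s))
         in (\<forall>\<^sub>F s in nhds t. y differentiable at s) \<and>
            (\<exists>y''. (y' has_vector_derivative y'') (at t) \<and>
                  (\<forall>w. g c (y t) y'' w + christoffel (g c) (y t) (y' t) (y' t) w = 0))))"

(* Used on compact, hence geodesically complete, manifolds only, where the geodesic with given
   initial data exists for all times and is unique. *)
definition riem_exp ::
  "'a topology \<Rightarrow> ('a, 'e::euclidean_space) chart set \<Rightarrow> ('a, 'e) metric \<Rightarrow> 'a \<Rightarrow> ('a, 'e) tangent_vector \<Rightarrow> 'a"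
  where
  "riem_exp M A g x v =
     (THE y. \<exists>\<gamma>. geodesic M A g \<gamma> \<and> \<gamma> 0 = x \<and> velocity A \<gamma> 0 = v \<and> \<gamma> 1 = y)"

(* A linear isometry from the Euclidean model space onto the tangent space at x; surjectivity is
   automatic by dimension. *)
definition tangent_frame ::
  "('a, 'e::euclidean_space) chart set \<Rightarrow> ('a, 'e) metric \<Rightarrow> 'a \<Rightarrow> ('e \<Rightarrow> ('a, 'e) tangent_vector) \<Rightarrow> bool"
  where
  "tangent_frame A g x J \<longleftrightarrow>
     (\<forall>a. J a \<in> tangent_space A x) \<and> (\<forall>c. linear (\<lambda>a. J a c)) \<and>
     (\<forall>a b. riem_inner A g x (J a) (J b) = a \<bullet> b)"

(* Geodesic normal coordinates centred at x: the inverse of exp_x on a ball on which exp_x is a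
   diffeomorphism onto an open subset of M, the tangent space being identified with the model
   space by J. *)
definition normal_chart ::
  "'a topology \<Rightarrow> ('a, 'e::euclidean_space) chart set \<Rightarrow> ('a, 'e) metric \<Rightarrow> 'a \<Rightarrow> ('a, 'e) chart \<Rightarrow> bool"
  where
  "normal_chart M A g x N \<longleftrightarrow>
     (\<exists>J \<rho>. tangent_frame A g x J \<and> \<rho> > 0 \<and>
        (let B = ball 0 \<rho>; E = riem_exp M A g x \<circ> J
         in inj_on E B \<and> N = (E ` B, inv_into B E) \<and> is_chart M N \<and>
            (\<forall>c\<in>A. smooth_transition N c \<and> smooth_transition c N)))"

definition point_cloud :: "'a topology \<Rightarrow> 'a set \<Rightarrow> bool" where
  "point_cloud M G \<longleftrightarrow> finite G \<and> G \<noteq> {} \<and> G \<subseteq> topspace M"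

definition mesh_width ::
  "'a topology \<Rightarrow> ('a, 'e::euclidean_space) chart set \<Rightarrow> ('a, 'e) metric \<Rightarrow> 'a set \<Rightarrow> ennreal" where
  "mesh_width M A g G = (SUP x\<in>topspace M. MIN y\<in>G. geodesic_dist M A g x y)"

definition finite_difference ::
  "real \<Rightarrow> nat \<Rightarrow> (nat \<Rightarrow> real) \<Rightarrow> (nat \<Rightarrow> 'a) \<Rightarrow> 'a \<Rightarrow> ('a \<Rightarrow> real) \<Rightarrow> real" where
  "finite_difference r k a x x0 v = 1 / r * (\<Sum>i=1..k. a i * (v (x i) - v x0))"

end

theory Submission
  imports Defs
begin

text \<open>
  Let \<open>e\<^sub>h = u - u\<^sup>h\<close>. By linearity, replacing \<open>u\<close> by \<open>u\<^sup>h\<close> in the scheme adds an error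
  \<open>\<D>\<^sub>\<nu> e\<^sub>h(x\<^sub>0)\<close>, which is \<open>O(h\<^sup>p / r)\<close> because the coefficients are bounded, to the
  consistency error \<open>O(r\<^sup>\<beta>)\<close>. With \<open>r\<close> of order \<open>q = p / (\<beta> + 1)\<close> in \<open>h\<close> both errors are of the
  order \<open>p - q = q \<beta>\<close>.
\<close>

lemma finite_difference_diff:
  "finite_difference r k a x x0 v - finite_difference r k a x x0 w =
     finite_difference r k a x x0 (\<lambda>y. v y - w y)"
  unfolding finite_difference_def right_diff_distrib[symmetric] sum_subtractf[symmetric]
  by (simp add: algebra_simps)

text \<open>The number \<open>k\<close> of terms is independent of \<open>h\<close>, so termwise
  bounds add up: a bounded coefficient times a difference of two \<open>O(b)\<close> terms is again
  \<open>O(b)\<close>. The prefactor \<open>1 / r h\<close> is carried along exactly, so no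
  assumption on \<open>r\<close> is needed at this point.\<close>

lemma finite_difference_bigo:
  assumes a: "\<And>i. i \<in> {1..k} \<Longrightarrow> (\<lambda>h. a h i) \<in> O[F](\<lambda>_. 1)"
    and e: "\<And>i. i \<in> {1..k} \<Longrightarrow> (\<lambda>h. e h (x h i)) \<in> O[F](b)"
    and e0: "(\<lambda>h. e h x0) \<in> O[F](b)"
  shows "(\<lambda>h. finite_difference (r h) k (a h) (x h) x0 (e h)) \<in> O[F](\<lambda>h. b h / r h)"
proof -
  have "(\<lambda>h. a h i * (e h (x h i) - e h x0)) \<in> O[F](b)" if "i \<in> {1..k}" for i
    using landau_o.big.mult[OF a sum_in_bigo(2)[OF e e0]] that by simp
  then have "(\<lambda>h. \<Sum>i=1..k. a h i * (e h (x h i) - e h x0)) \<in> O[F](b)"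
    by (rule big_sum_in_bigo)
  from landau_o.big.mult[OF landau_o.big_refl this, of "\<lambda>h. 1 / r h"] show ?thesis
    by (simp add: finite_difference_def)
qed

theorem theorem26:
  fixes M :: "'a topology"
    and A :: "('a, real ^ 'd) chart set"
    and g :: "('a, real ^ 'd) metric"
    and N :: "('a, real ^ 'd) chart"
    and \<nu> :: "('a, real ^ 'd) tangent_vector"
    and u :: "'a \<Rightarrow> real" and x0 :: 'a
    and H :: "real set" and G :: "real \<Rightarrow> 'a set" and uh :: "real \<Rightarrow> 'a \<Rightarrow> real"
    and r :: "real \<Rightarrow> real" and k :: nat
    and a :: "real \<Rightarrow> nat \<Rightarrow> real" and x :: "real \<Rightarrow> nat \<Rightarrow> 'a"
    and p \<beta> :: real
  assumes manifold: "compact_riemannian_manifold M A g"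
    and u_C1: "C1_manifold A u"
    and x0: "x0 \<in> topspace M"
    and \<nu>: "\<nu> \<in> tangent_space A x0" "riem_norm A g x0 \<nu> = 1"
    and normal_coordinates: "normal_chart M A g x0 N"
    and mesh_widths: "H \<subseteq> {0<..}"
    and clouds: "\<forall>h\<in>H. point_cloud M (G h) \<and> mesh_width M A g (G h) = ennreal h"
    and stencil: "\<forall>h\<in>H. \<forall>i\<in>{1..k}. x h i \<in> G h"
    and p: "p > 0"
    and approximation:
      "\<exists>C. \<forall>\<^sub>F h in at 0 within H. \<forall>y\<in>insert x0 (G h). \<bar>u y - uh h y\<bar> \<le> C * h powr p"
    and width: "\<forall>h\<in>H. r h \<ge> h"
    and stencil_distance:
      "\<exists>C1>0. \<exists>C2>0. \<forall>\<^sub>F h in at 0 within H. \<forall>i\<in>{1..k}.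
         x h i \<in> fst N \<and>
         C1 * r h \<le> norm (snd N (x h i) - snd N x0) \<and> norm (snd N (x h i) - snd N x0) \<le> C2 * r h"
    and \<beta>: "\<beta> > 0"
    and consistency:
      "(\<lambda>h. finite_difference (r h) k (a h) (x h) x0 u - directional_derivative A u x0 \<nu>)
         \<in> O[at 0 within H](\<lambda>h. r h powr \<beta>)"
    and coefficients: "\<forall>i\<in>{1..k}. (\<lambda>h. a h i) \<in> O[at 0 within H](\<lambda>_. 1)"
    and choice: "r \<in> \<Theta>[at 0 within H](\<lambda>h. h powr (p / (\<beta> + 1)))"
  shows "(\<lambda>h. directional_derivative A u x0 \<nu> - finite_difference (r h) k (a h) (x h) x0 (uh h))
           \<in> O[at 0 within H](\<lambda>h. h powr (p * \<beta> / (\<beta> + 1)))"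
proof -
  let ?F = "at 0 within H"
  define q where "q = p / (\<beta> + 1)"
  have q\<beta>: "q * \<beta> = p * \<beta> / (\<beta> + 1)" and pq: "p - q = p * \<beta> / (\<beta> + 1)"
    using \<beta> by (simp_all add: q_def field_simps)
  have inH: "\<forall>\<^sub>F h in ?F. h \<in> H"
    by (simp add: eventually_at_filter)
  have h_pos: "0 < h" if "h \<in> H" for h
    using mesh_widths that by auto
  have r_pos: "0 < r h" if "h \<in> H" for h
    using width h_pos that by fastforce
  \<comment> \<open>The upper half of \<open>choice\<close> controls the consistency error: raising
    to the power \<beta> > 0 preserves the bound, since the base is eventually nonnegative.\<close>
  have "(\<lambda>h. r h powr \<beta>) \<in> O[?F](\<lambda>h. (h powr q) powr \<beta>)"
  proof (rule bigo_powr_nonneg)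
    show "r \<in> O[?F](\<lambda>h. h powr q)"
      using bigthetaD1[OF choice] by (simp add: q_def)
    show "\<forall>\<^sub>F h in ?F. 0 \<le> r h"
      using inH by eventually_elim (use r_pos in \<open>simp add: less_imp_le\<close>)
  qed (use \<beta> in simp_all)
  then have consistency_error:
    "(\<lambda>h. finite_difference (r h) k (a h) (x h) x0 u - directional_derivative A u x0 \<nu>)
       \<in> O[?F](\<lambda>h. h powr (p * \<beta> / (\<beta> + 1)))"
    using landau_o.big_trans[OF consistency] by (simp add: powr_powr q\<beta>)
  define e where "e = (\<lambda>h y. u y - uh h y)"
  obtain C where C: "\<forall>\<^sub>F h in ?F. \<forall>y\<in>insert x0 (G h). \<bar>e h y\<bar> \<le> C * h powr p"
    using approximation unfolding e_def by blast
  have "(\<lambda>h. finite_difference (r h) k (a h) (x h) x0 (e h)) \<in> O[?F](\<lambda>h. h powr p / r h)"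
  proof (rule finite_difference_bigo)
    \<comment> \<open>The scheme also samples the error at \<open>x0\<close>, which may lie outside
      the cloud; hence the bound on \<open>insert x0 (G h)\<close>.\<close>
    show "(\<lambda>h. e h x0) \<in> O[?F](\<lambda>h. h powr p)"
      by (rule bigoI[of _ C]) (use C in eventually_elim, simp)
    \<comment> \<open>The stencil point moves with \<open>h\<close>, so a bound at each fixed point
      would not do: the constant \<open>C\<close> has to be uniform over the cloud.\<close>
    show "(\<lambda>h. e h (x h i)) \<in> O[?F](\<lambda>h. h powr p)" if "i \<in> {1..k}" for i
      by (rule bigoI[of _ C]) (use C inH in eventually_elim, use stencil that in simp)
  qed (use coefficients in blast)
  \<comment> \<open>Here \<open>r\<close> is in the denominator, so the lower half of
    \<open>choice\<close> is what counts: a smaller stencil width would amplify the error of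
    \<open>uh\<close>.\<close>
  also have "(\<lambda>h. h powr p / r h) \<in> O[?F](\<lambda>h. h powr p / h powr q)"
  proof (rule landau_o.big.divide_left)
    show "\<forall>\<^sub>F h in ?F. r h \<noteq> 0"
      using inH by eventually_elim (use r_pos in force)
    show "\<forall>\<^sub>F h in ?F. h powr q \<noteq> 0"
      using inH by eventually_elim (use h_pos in force)
    show "(\<lambda>h. h powr q) \<in> O[?F](r)"
      using bigthetaD2[OF choice] by (simp add: q_def bigomega_iff_bigo)
  qed
  \<comment> \<open>An equality of functions on all reals; at \<open>h = 0\<close> both sides are
    0.\<close>
  also have "(\<lambda>h. h powr p / h powr q) = (\<lambda>h. h powr (p * \<beta> / (\<beta> + 1)))"
    by (simp add: pq flip: powr_diff)
  finally have "(\<lambda>h. finite_difference (r h) k (a h) (x h) x0 u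
                  - finite_difference (r h) k (a h) (x h) x0 (uh h))
                \<in> O[?F](\<lambda>h. h powr (p * \<beta> / (\<beta> + 1)))"
    by (simp add: finite_difference_diff e_def)
  \<comment> \<open>Subtracting the consistency error from the propagated error cancels the scheme
    applied to \<open>u\<close>.\<close>
  from sum_in_bigo(2)[OF this consistency_error] show ?thesis
    by simp
qed

end
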